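(* Let $L\in\mathbb{R}^{p\times n}$ and $\tilde L\in\mathbb{R}^{\tilde p\times n}$ both be column orthogonal. Then, for a given regularization parameter $\lambda$, it makes no difference whether $L$ or $\tilde L$ is used as the regularization matrix for the generalized Tikhonov problem $$\min_{x\in\mathbb{R}^n}\left\{\frac12\|Ax-b\|_2^2+\frac{\lambda^2}{2}\|Lx\|_2^2\right\},$$ as for both matrices the problem reduces to the standard Tikhonov problem, i.e. the problem with regularization matrix $L=I$, $$\min_{x\in\mathbb{R}^n}\left\{\frac12\|Ax-b\|_2^2+\frac{\lambda^2}{2}\|x\|_2^2\right\}.$$ Thus, the solutions obtained with $L$ and with $\tilde L$ will be the same, to machine precision.
   Context: Here $A\in\mathbb{R}^{m\times n}$ is the system (forward) matrix and $b\in\mathbb{R}^m$ is the data vector of the inverse problem $Ax\approx b$. A matrix $C\in\mathbb{R}^{q\times n}$ with $q\ge n$ is called column orthogonal if $C^\top C=I_n$, where $I_n$ (also written $I$) is the $n\times n$ identity matrix. Using $\tilde L$ as the regularization matrix means replacing $L$ by $\tilde L$ in the generalized Tikhonov problem, with the same $A$, $b$ and $\lambda$. *)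

theory Defs
  imports "HOL-Analysis.Analysis"
begin

text \<open>
  Matrices in \<open>\<real>\<^sup>p\<^sup>\<times>\<^sup>n\<close> have type \<^typ>\<open>real ^ 'n ^ 'p\<close>; the norm on \<^typ>\<open>real ^ 'n\<close> is
  the Euclidean one.
\<close>

text \<open>The size condition \<open>q \<ge> n\<close> is implied by the equation; it is kept as part of the notion.\<close>

definition column_orthogonal :: "real ^ 'n ^ 'q \<Rightarrow> bool" where
  "column_orthogonal C \<longleftrightarrow> CARD('n) \<le> CARD('q) \<and> transpose C ** C = mat 1"

definition tikhonov_objective ::
    "real ^ 'n ^ 'm \<Rightarrow> real ^ 'm \<Rightarrow> real \<Rightarrow> real ^ 'n ^ 'p \<Rightarrow> real ^ 'n \<Rightarrow> real" where
  "tikhonov_objective A b lam L x =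
     1 / 2 * (norm (A *v x - b))\<^sup>2 + lam\<^sup>2 / 2 * (norm (L *v x))\<^sup>2"

definition standard_tikhonov_objective ::
    "real ^ 'n ^ 'm \<Rightarrow> real ^ 'm \<Rightarrow> real \<Rightarrow> real ^ 'n \<Rightarrow> real" where
  "standard_tikhonov_objective A b lam x =
     1 / 2 * (norm (A *v x - b))\<^sup>2 + lam\<^sup>2 / 2 * (norm x)\<^sup>2"

text \<open>
  Solutions are the global minimizers. They form a set, since for \<open>lam = 0\<close> the minimizer
  need not be unique.
\<close>

definition minimizers :: "('a \<Rightarrow> real) \<Rightarrow> 'a set" where
  "minimizers f = {x. is_arg_min f (\<lambda>_. True) x}"

definition tikhonov_solutions ::
    "real ^ 'n ^ 'm \<Rightarrow> real ^ 'm \<Rightarrow> real \<Rightarrow> real ^ 'n ^ 'p \<Rightarrow> (real ^ 'n) set" where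
  "tikhonov_solutions A b lam L = minimizers (tikhonov_objective A b lam L)"

definition standard_tikhonov_solutions ::
    "real ^ 'n ^ 'm \<Rightarrow> real ^ 'm \<Rightarrow> real \<Rightarrow> (real ^ 'n) set" where
  "standard_tikhonov_solutions A b lam = minimizers (standard_tikhonov_objective A b lam)"

end

theory Submission
  imports Defs
begin

text \<open>
  The matrix \<open>L\<close> enters the objective only through \<open>\<parallel>L x\<parallel>\<^sup>2 = x \<bullet> (L\<^sup>T L x)\<close>. If
  \<open>L\<^sup>T L = I\<close>, this is \<open>\<parallel>x\<parallel>\<^sup>2\<close>, so the generalized and the standard objective are the same
  function of \<open>x\<close>. The sets of minimizers then agree without any appeal to existence or
  uniqueness of a minimizer, hence also for \<open>lam = 0\<close>.
\<close>

lemma norm_column_orthogonal: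
  fixes C :: "real ^ 'n ^ 'q"
  assumes "column_orthogonal C"
  shows "norm (C *v x) = norm x"
proof -
  have "(C *v x) \<bullet> (C *v x) = (transpose C *v (C *v x)) \<bullet> x"
    by (simp only: transpose_matrix_vector dot_lmul_matrix)
  also have "\<dots> = x \<bullet> x"
    using assms by (simp add: column_orthogonal_def matrix_vector_mul_assoc del: transpose_matrix_vector)
  finally show ?thesis
    by (simp add: norm_eq)
qed

lemma tikhonov_objective_column_orthogonal:
  assumes "column_orthogonal L"
  shows "tikhonov_objective A b lam L = standard_tikhonov_objective A b lam"
  by (rule ext)
    (simp add: tikhonov_objective_def standard_tikhonov_objective_def
      norm_column_orthogonal[OF assms])

lemma column_orthogonal_mat_1: "column_orthogonal (mat 1 :: real ^ 'n ^ 'n)"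
  by (simp add: column_orthogonal_def transpose_mat)

theorem corollary3p4:
  fixes A :: "real ^ 'n ^ 'm" and b :: "real ^ 'm" and lam :: real
    and L :: "real ^ 'n ^ 'p" and L' :: "real ^ 'n ^ 'q"
  assumes "column_orthogonal L" and "column_orthogonal L'"
  shows "tikhonov_objective A b lam L = standard_tikhonov_objective A b lam
    \<and> tikhonov_objective A b lam L' = standard_tikhonov_objective A b lam
    \<and> tikhonov_objective A b lam (mat 1 :: real ^ 'n ^ 'n) = standard_tikhonov_objective A b lam
    \<and> tikhonov_solutions A b lam L = standard_tikhonov_solutions A b lam
    \<and> tikhonov_solutions A b lam L' = standard_tikhonov_solutions A b lam
    \<and> tikhonov_solutions A b lam L = tikhonov_solutions A b lam L'"
  by (simp add: tikhonov_solutions_def standard_tikhonov_solutions_def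
      tikhonov_objective_column_orthogonal assms column_orthogonal_mat_1)

end
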